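(* Let $\rho_{AB}$ be a 2-qubit mixed state, i.e. a density matrix on $\mathbb{C}^2\otimes\mathbb{C}^2$ of rank at least $2$, with Alice holding the first qubit and Bob the second. Then there is no contradiction "2=1" for $\rho_{AB}$: there is no 2-setting steering protocol $\{\hat n_1,\hat n_2\}$, i.e. no pair of projective measurements $\{P_a^{\hat n_1}\}_{a=0,1}$, $\{P_{a'}^{\hat n_2}\}_{a'=0,1}$ of Alice, each consisting of the two rank-one projectors onto the vectors of an orthonormal basis of $\mathbb{C}^2$, for which the pure state requirement and the measurement requirement are satisfied simultaneously.
   Context: For Alice's rank-one projector $P_a^{\hat n_k}$ ($k=1,2$), Bob's unnormalized conditional state is $\tilde\rho_a^{\hat n_k}=\mathrm{tr}_A\big[(P_a^{\hat n_k}\otimes \mathbb{1})\rho_{AB}\big]$, where $\mathbb{1}$ is the $2\times2$ identity matrix and $\mathrm{tr}_A$ is the partial trace over Alice's qubit. Pure state requirement: Bob's unnormalized conditional states $\{\tilde\rho_a^{\hat n_1}\}$ and $\{\tilde\rho_{a'}^{\hat n_2}\}$ are all pure, where an unnormalized state is pure if it is a positive multiple of a rank-one orthogonal projector. Measurement requirement: any one of the pure states in $\{\tilde\rho_a^{\hat n_1}\}$ is different from any one of the pure states in $\{\tilde\rho_{a'}^{\hat n_2}\}$, where two unnormalized pure states are different if they are not proportional. Outcomes of zero probability (for which the conditional state is the zero operator) produce no state for Bob and are disregarded in the two requirements. The contradiction "2=1" is said to be present for a state and a 2-setting protocol when both of these requirements are satisfied simultaneously. *)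

theory Defs
  imports "HOL-Analysis.Analysis"
begin

text \<open>
  The inner product of \<^typ>\<open>complex^'n\<close> in the library is the real one, so the Hermitian one
  is defined here, conjugate-linear in its first argument.
\<close>

definition cinner :: "complex^'n \<Rightarrow> complex^'n \<Rightarrow> complex" where
  "cinner v w = (\<Sum>i\<in>UNIV. cnj (v $ i) * w $ i)"

definition dagger :: "complex^'n^'m \<Rightarrow> complex^'m^'n" where
  "dagger A = (\<chi> i j. cnj (A $ j $ i))"

definition hermitian :: "complex^'n^'n \<Rightarrow> bool" where
  "hermitian A \<longleftrightarrow> dagger A = A"

definition positive_semidefinite :: "complex^'n^'n \<Rightarrow> bool" where
  "positive_semidefinite A \<longleftrightarrow> hermitian A \<and> (\<forall>v. 0 \<le> Re (cinner v (A *v v)))"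

definition density_matrix :: "complex^'n^'n \<Rightarrow> bool" where
  "density_matrix \<rho> \<longleftrightarrow> positive_semidefinite \<rho> \<and> trace \<rho> = 1"

definition orthogonal_projector :: "complex^'n^'n \<Rightarrow> bool" where
  "orthogonal_projector P \<longleftrightarrow> hermitian P \<and> P ** P = P"

text \<open>
  The index type \<^typ>\<open>'a \<times> 'b\<close> represents the tensor product of the spaces indexed
  by \<^typ>\<open>'a\<close> (Alice) and \<^typ>\<open>'b\<close> (Bob).
\<close>

definition tensor_mat ::
  "complex^'a^'a \<Rightarrow> complex^'b^'b \<Rightarrow> complex^('a::finite \<times> 'b::finite)^('a \<times> 'b)" where
  "tensor_mat A B = (\<chi> p q. A $ fst p $ fst q * B $ snd p $ snd q)"

definition partial_trace_A :: "complex^('a::finite \<times> 'b::finite)^('a \<times> 'b) \<Rightarrow> complex^'b^'b" where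
  "partial_trace_A M = (\<chi> k l. \<Sum>i\<in>UNIV. M $ (i, k) $ (i, l))"

text \<open>
  As the family is indexed by the coordinate type itself, orthonormality alone makes it a basis.
\<close>

definition orthonormal_basis :: "('n \<Rightarrow> complex^'n) \<Rightarrow> bool" where
  "orthonormal_basis v \<longleftrightarrow> (\<forall>a b. cinner (v a) (v b) = (if a = b then 1 else 0))"

text \<open>The matrix \<open>|v><v|\<close>, the projector onto the line of \<open>v\<close> if \<open>v\<close> is a unit vector.\<close>

definition ket_bra :: "complex^'n \<Rightarrow> complex^'n^'n" where
  "ket_bra v = (\<chi> i j. v $ i * cnj (v $ j))"

text \<open>The two outcomes are the elements \<open>0\<close> and \<open>1\<close> of the type \<^typ>\<open>2\<close>.\<close>

definition projective_measurement :: "(2 \<Rightarrow> complex^2^2) \<Rightarrow> bool" where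
  "projective_measurement P \<longleftrightarrow> (\<exists>v. orthonormal_basis v \<and> (\<forall>a. P a = ket_bra (v a)))"

definition conditional_state :: "complex^(2 \<times> 2)^(2 \<times> 2) \<Rightarrow> complex^2^2 \<Rightarrow> complex^2^2" where
  "conditional_state \<rho> P = partial_trace_A (tensor_mat P (mat 1) ** \<rho>)"

text \<open>Outcomes of zero probability, whose conditional state is \<open>0\<close>, are left out.\<close>

definition conditional_states ::
  "complex^(2 \<times> 2)^(2 \<times> 2) \<Rightarrow> (2 \<Rightarrow> complex^2^2) \<Rightarrow> (complex^2^2) set" where
  "conditional_states \<rho> P = range (\<lambda>a. conditional_state \<rho> (P a)) - {0}"

definition pure_unnormalized :: "complex^'n^'n \<Rightarrow> bool" where
  "pure_unnormalized \<sigma> \<longleftrightarrow>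
    (\<exists>c P. c > 0 \<and> orthogonal_projector P \<and> rank P = 1 \<and> \<sigma> = c *\<^sub>R P)"

definition proportional :: "complex^'n^'n \<Rightarrow> complex^'n^'n \<Rightarrow> bool" where
  "proportional \<sigma> \<tau> \<longleftrightarrow> (\<exists>c. c \<noteq> 0 \<and> \<sigma> = map_matrix (\<lambda>z. c * z) \<tau>)"

definition pure_state_requirement ::
  "complex^(2 \<times> 2)^(2 \<times> 2) \<Rightarrow> (2 \<Rightarrow> complex^2^2) \<Rightarrow> (2 \<Rightarrow> complex^2^2) \<Rightarrow> bool" where
  "pure_state_requirement \<rho> P Q \<longleftrightarrow>
    (\<forall>\<sigma> \<in> conditional_states \<rho> P \<union> conditional_states \<rho> Q. pure_unnormalized \<sigma>)"

definition measurement_requirement ::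
  "complex^(2 \<times> 2)^(2 \<times> 2) \<Rightarrow> (2 \<Rightarrow> complex^2^2) \<Rightarrow> (2 \<Rightarrow> complex^2^2) \<Rightarrow> bool" where
  "measurement_requirement \<rho> P Q \<longleftrightarrow>
    (\<forall>\<sigma> \<in> conditional_states \<rho> P. \<forall>\<tau> \<in> conditional_states \<rho> Q. \<not> proportional \<sigma> \<tau>)"

definition contradiction_2_eq_1 ::
  "complex^(2 \<times> 2)^(2 \<times> 2) \<Rightarrow> (2 \<Rightarrow> complex^2^2) \<Rightarrow> (2 \<Rightarrow> complex^2^2) \<Rightarrow> bool" where
  "contradiction_2_eq_1 \<rho> P Q \<longleftrightarrow> pure_state_requirement \<rho> P Q \<and> measurement_requirement \<rho> P Q"

end

theory Submission imports Defs begin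

text \<open>
  If Alice measures in an orthonormal basis \<open>v\<close> and Bob's conditional states are \<open>|b a><b a|\<close>
  (with \<open>b a = 0\<close> for an outcome of zero probability), then positivity forces \<open>\<rho>\<close> to kill
  \<open>v a \<otimes> x\<close> for every \<open>x\<close> orthogonal to \<open>b a\<close>, so the range of \<open>\<rho>\<close> lies in the span of the two
  vectors \<open>v a \<otimes> b a\<close>. The same holds for a second basis \<open>w\<close> with states \<open>|c a><c a|\<close>, and as the
  rank is at least 2, the range is then all of the span of the \<open>w a \<otimes> c a\<close>. Hence \<open>w 0 \<otimes> c 0\<close> is a
  combination of the \<open>v a \<otimes> b a\<close>; contracting with a \<open>v a\<close> not orthogonal to \<open>w 0\<close> shows that
  \<open>c 0\<close> is a multiple of \<open>b a\<close>, against the measurement requirement.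
\<close>

section \<open>Hermitian inner product, kernels of positive matrices, rank\<close>

lemma cinner_add_left: "cinner (x + y) z = cinner x z + cinner y z"
  by (simp add: cinner_def algebra_simps sum.distrib)

lemma cinner_add_right: "cinner z (x + y) = cinner z x + cinner z y"
  by (simp add: cinner_def algebra_simps sum.distrib)

lemma cinner_diff_right: "cinner z (x - y) = cinner z x - cinner z y"
  by (simp add: cinner_def algebra_simps sum_subtractf)

lemma cinner_scale_left: "cinner (c *s x) y = cnj c * cinner x y"
  by (simp add: cinner_def sum_distrib_left mult.assoc)

lemma cinner_scale_right: "cinner x (c *s y) = c * cinner x y"
  by (simp add: cinner_def sum_distrib_left mult.left_commute)

lemma cinner_zero_left [simp]: "cinner 0 x = 0"
  by (simp add: cinner_def)

lemma cinner_zero_right [simp]: "cinner x 0 = 0"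
  by (simp add: cinner_def)

lemma cnj_cinner: "cnj (cinner x y) = cinner y x"
  by (simp add: cinner_def mult.commute)

lemma cinner_self: "cinner x x = complex_of_real (\<Sum>i\<in>UNIV. (cmod (x $ i))\<^sup>2)"
  by (simp add: cinner_def complex_norm_square mult.commute del: of_real_power)

lemma cinner_self_eq_0_iff [simp]: "cinner x x = 0 \<longleftrightarrow> x = 0"
  by (simp add: cinner_self of_real_eq_0_iff sum_nonneg_eq_0_iff vec_eq_iff del: of_real_sum)

lemma Re_cinner_self_nonneg: "0 \<le> Re (cinner x x)"
  by (simp add: cinner_self sum_nonneg del: of_real_sum)

lemma cinner_matrix_vector: "cinner x (A *v y) = (\<Sum>i\<in>UNIV. \<Sum>j\<in>UNIV. cnj (x $ i) * A $ i $ j * y $ j)"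
  by (simp add: cinner_def matrix_vector_mult_def sum_distrib_left mult.assoc)

lemma cinner_hermitian:
  assumes "hermitian A"
  shows "cinner x (A *v y) = cinner (A *v x) y"
proof -
  have A: "A $ i $ j = cnj (A $ j $ i)" for i j
    using assms unfolding hermitian_def dagger_def by (metis vec_lambda_beta)
  have "cinner (A *v x) y = cnj (cinner y (A *v x))"
    by (simp add: cnj_cinner)
  also have "\<dots> = (\<Sum>i\<in>UNIV. \<Sum>j\<in>UNIV. cnj (x $ j) * cnj (A $ i $ j) * y $ i)"
    by (simp add: cinner_matrix_vector algebra_simps)
  also have "\<dots> = (\<Sum>j\<in>UNIV. \<Sum>i\<in>UNIV. cnj (x $ j) * A $ j $ i * y $ i)"
    by (subst sum.swap) (simp flip: A)
  finally show ?thesis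
    by (simp add: cinner_matrix_vector)
qed

text \<open>Moving from \<open>x\<close> in the direction \<open>A *v x\<close>, the quadratic form
  starts at 0 and may not become negative, so its first-order term, twice the squared norm of
  \<open>A *v x\<close>, must vanish.\<close>

lemma positive_semidefinite_kernel:
  assumes A: "positive_semidefinite A" and x: "cinner x (A *v x) = 0"
  shows "A *v x = 0"
proof -
  define y where "y = A *v x"
  define N where "N = Re (cinner y y)"
  define C where "C = Re (cinner y (A *v y))"
  have herm: "hermitian A"
    using A by (simp add: positive_semidefinite_def)
  have q: "0 \<le> 2 * t * N + t\<^sup>2 * C" for t :: real
  proof -
    let ?z = "x + complex_of_real t *s y"
    have "0 \<le> Re (cinner ?z (A *v ?z))"
      using A by (simp add: positive_semidefinite_def)
    also have "cinner ?z (A *v ?z) =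
        cinner x (A *v x) + t * cinner x (A *v y) + t * cinner y (A *v x) + t\<^sup>2 * cinner y (A *v y)"
      by (simp add: cinner_add_left cinner_add_right cinner_scale_left cinner_scale_right
          vec.add vec.scale algebra_simps power2_eq_square)
    also have "cinner x (A *v y) = cinner y y"
      by (simp add: cinner_hermitian[OF herm] y_def)
    finally show ?thesis
      using x by (simp add: C_def N_def mult.assoc flip: y_def of_real_power)
  qed
  have "0 \<le> C"
    using A by (simp add: positive_semidefinite_def C_def)
  have "0 \<le> N"
    by (simp add: N_def Re_cinner_self_nonneg)
  have "N = 0"
  proof (cases "C = 0")
    case True
    then show ?thesis using q[of "-1"] \<open>0 \<le> N\<close> by simp
  next
    case False
    \<comment> \<open>The value \<open>- N / C\<close> of \<open>t\<close> is the minimum point of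
      the parabola in \<open>q\<close>.\<close>
    then have "2 * (- N / C) * N + (- N / C)\<^sup>2 * C = - (N\<^sup>2 / C)"
      by (simp add: field_simps power2_eq_square)
    then have "N\<^sup>2 / C \<le> 0"
      using q[of "- N / C"] by simp
    then show ?thesis
      using False \<open>0 \<le> C\<close> by (simp add: divide_le_0_iff)
  qed
  then have "cinner y y = 0"
    by (simp add: N_def cinner_self del: of_real_sum)
  then show ?thesis by (simp add: y_def)
qed

text \<open>The component of \<open>r\<close> orthogonal to \<open>b\<close> is, by assumption,
  orthogonal to \<open>r\<close> as well, hence to itself.\<close>

lemma double_orthogonal_complement_line:
  assumes "\<And>x. cinner b x = 0 \<Longrightarrow> cinner x r = 0"
  shows "\<exists>c. r = c *s b"
proof -
  \<comment> \<open>The coefficient of the projection of \<open>r\<close> onto \<open>b\<close>; if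
    \<open>b = 0\<close>, division by zero makes it 0, and \<open>x\<close> is
    \<open>r\<close>.\<close>
  define c where "c = cinner b r / cinner b b"
  define x where "x = r - c *s b"
  have b: "cinner b x = 0"
    by (cases "b = 0") (simp_all add: x_def c_def cinner_diff_right cinner_scale_right)
  have "cinner x b = 0"
    using b cnj_cinner[of b x] by simp
  then have "cinner x x = 0"
    using assms[OF b] by (subst (2) x_def) (simp add: cinner_diff_right cinner_scale_right)
  then show ?thesis by (auto simp: x_def)
qed

text \<open>In the library \<^const>\<open>rank\<close> is the row rank, identified with the column rank over the reals only.\<close>

lemma rank_le_dim_range:
  fixes A :: "'a::field^'n^'m"
  shows "rank A \<le> vec.dim (range ((*v) A))"
proof -
  obtain B where B: "vec.independent B" "range ((*v) A) \<subseteq> vec.span B"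
      "card B = vec.dim (range ((*v) A))"
    using vec.basis_exists .
  have fin: "finite B"
    using B(1) by (rule vec.finiteI_independent)
  have "\<exists>u. column j A = (\<Sum>b\<in>B. u b *s b)" for j
  proof -
    have A: "column j A = A *v axis j 1"
      by (simp add: vec_eq_iff matrix_vector_mult_def column_def axis_def if_distrib[of "\<lambda>z. _ * z"] cong: if_cong)
    have "column j A \<in> vec.span B"
      using B(2) A by (metis range_subsetD)
    then show ?thesis
      unfolding vec.span_finite[OF fin] by auto
  qed
  then obtain u where u: "column j A = (\<Sum>b\<in>B. u j b *s b)" for j
    by metis
  \<comment> \<open>The coefficients of the columns with respect to \<open>B\<close>, read along
    rows: each row of \<open>A\<close> is a combination of the \<open>f b\<close>, with the entries
    of the \<open>b\<close> as coefficients.\<close>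
  define f where "f b = (\<chi> j. u j b)" for b
  have "row i A = (\<Sum>b\<in>B. (b $ i) *s f b)" for i
  proof -
    have "A $ i $ j = (\<Sum>b\<in>B. u j b * b $ i)" for j
      using arg_cong[OF u[of j], of "\<lambda>x. x $ i"] by (simp add: column_def)
    then show ?thesis
      by (simp add: vec_eq_iff row_def f_def mult.commute)
  qed
  then have "rows A \<subseteq> vec.span (f ` B)"
    by (auto simp: rows_def intro!: vec.span_sum vec.span_scale intro: vec.span_base)
  then have "rank A \<le> card (f ` B)"
    unfolding row_rank_def_gen using fin by (intro vec.dim_le_card) auto
  also have "\<dots> \<le> card B"
    using fin by (rule card_image_le)
  finally show ?thesis using B(3) by simp
qed

section \<open>Pure states as matrices \<open>ket_bra b\<close>\<close>

lemma ket_bra_vector: "ket_bra b *v x = cinner b x *s b"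
  by (simp add: vec_eq_iff ket_bra_def matrix_vector_mult_def cinner_def sum_distrib_left sum_distrib_right mult_ac)

lemma ket_bra_eq_0_iff [simp]: "ket_bra b = 0 \<longleftrightarrow> b = 0"
  by (auto simp: ket_bra_def vec_eq_iff)

lemma ket_bra_scale: "ket_bra (c *s b) = map_matrix (\<lambda>z. (c * cnj c) * z) (ket_bra b)"
  by (simp add: ket_bra_def vec_eq_iff map_matrix_def mult_ac)

text \<open>All rows are multiples of a single \<open>u\<close>. For \<open>u\<close> nonzero,
  hermiticity makes the column factor a multiple \<open>k\<close> of the conjugate of
  \<open>u\<close>, and idempotency leaves only nonnegative values of \<open>k\<close>, whose square
  root is absorbed into the vector.\<close>

lemma orthogonal_projector_rank_1:
  assumes P: "orthogonal_projector P" and rk: "rank P = 1"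
  obtains b where "P = ket_bra b"
proof -
  obtain B where B: "rows P \<subseteq> vec.span B" "card B = 1"
    using rk vec.basis_exists[of "rows P"] unfolding row_rank_def_gen by metis
  then obtain u where u: "B = {u}"
    by (meson card_1_singletonE)
  have "\<exists>c. row i P = c *s u" for i
    using B(1) unfolding u rows_def vec.span_singleton by blast
  then obtain \<alpha> where \<alpha>: "row i P = \<alpha> i *s u" for i
    by metis
  have P1: "P $ i $ j = \<alpha> i * u $ j" for i j
    using \<alpha>[of i] by (simp add: vec_eq_iff row_def)
  have herm: "P $ i $ j = cnj (P $ j $ i)" for i j
    using P unfolding orthogonal_projector_def hermitian_def dagger_def by (metis vec_lambda_beta)
  show thesis
  proof (cases "u = 0")
    case True
    then have "P = ket_bra 0" by (simp add: vec_eq_iff P1 ket_bra_def)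
    then show thesis by (rule that)
  next
    case False
    then obtain m where m: "u $ m \<noteq> 0" by (auto simp: vec_eq_iff)
    define w where "w = (\<chi> i. cnj (u $ i))"
    \<comment> \<open>Obtained by solving the hermiticity condition at entry \<open>(i, m)\<close>
      for \<open>\<alpha> i\<close>.\<close>
    define k where "k = cnj (\<alpha> m) / u $ m"
    have "\<alpha> i = k * w $ i" for i
      using herm[of i m] m by (simp add: P1 k_def w_def field_simps)
    then have Pk: "P = map_matrix (\<lambda>z. k * z) (ket_bra w)"
      by (simp add: vec_eq_iff P1 ket_bra_def map_matrix_def w_def mult_ac)
    have "w \<noteq> 0"
      using m by (auto simp: w_def vec_eq_iff)
    have Pv: "P *v x = (k * cinner w x) *s w" for x
      by (simp add: Pk vec_eq_iff map_matrix_def ket_bra_def matrix_vector_mult_def cinner_def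
          sum_distrib_left sum_distrib_right mult_ac)
    have "P *v (P *v w) = P *v w"
      using P by (simp add: orthogonal_projector_def matrix_vector_mul_assoc)
    then have "(k * cinner w w) * (k * cinner w w) = k * cinner w w"
      using \<open>w \<noteq> 0\<close> by (auto simp: Pv cinner_scale_right vec_eq_iff mult_ac)
    then have "k = 0 \<or> k = 1 / cinner w w"
      using \<open>w \<noteq> 0\<close> by (auto simp: field_simps)
    then have "\<exists>s. k = complex_of_real s * complex_of_real s"
    proof
      assume k: "k = 1 / cinner w w"
      define n where "n = (\<Sum>i\<in>UNIV. (cmod (w $ i))\<^sup>2)"
      have "0 \<le> n" by (simp add: n_def sum_nonneg)
      then have "k = complex_of_real (sqrt (1 / n)) * complex_of_real (sqrt (1 / n))"
        by (simp add: k cinner_self flip: n_def of_real_mult del: of_real_sum)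
      then show ?thesis by blast
    qed auto
    then obtain s where "k = complex_of_real s * complex_of_real s" by blast
    then have "P = ket_bra (complex_of_real s *s w)"
      by (simp add: Pk ket_bra_scale)
    then show thesis by (rule that)
  qed
qed

lemma pure_unnormalized_ket_bra:
  assumes "pure_unnormalized \<sigma>"
  obtains b where "\<sigma> = ket_bra b"
proof -
  obtain c P where c: "c > 0" and P: "orthogonal_projector P" "rank P = 1" and \<sigma>: "\<sigma> = c *\<^sub>R P"
    using assms unfolding pure_unnormalized_def by blast
  obtain b where b: "P = ket_bra b"
    using orthogonal_projector_rank_1[OF P] .
  have "complex_of_real (sqrt c) * complex_of_real (sqrt c) = complex_of_real c"
    using c by (simp flip: of_real_mult)
  moreover have "(c *\<^sub>R P) $ i $ j = complex_of_real c * P $ i $ j" for i j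
    by (simp add: complex_eq_iff)
  ultimately have "\<sigma> = ket_bra (complex_of_real (sqrt c) *s b)"
    unfolding ket_bra_scale by (simp add: \<sigma> b vec_eq_iff map_matrix_def)
  then show thesis by (rule that)
qed

section \<open>Product vectors and contraction with a vector of Alice\<close>

definition tensor_vec :: "complex^'a \<Rightarrow> complex^'b \<Rightarrow> complex^('a::finite \<times> 'b::finite)" where
  "tensor_vec v x = (\<chi> p. v $ fst p * x $ snd p)"

text \<open>The partial inner product with \<open>v\<close> on Alice's side, which is the adjoint of
  \<open>tensor_vec v\<close>.\<close>

definition contract_A :: "complex^'a \<Rightarrow> complex^('a::finite \<times> 'b::finite) \<Rightarrow> complex^'b" where
  "contract_A v y = (\<chi> k. \<Sum>i\<in>UNIV. cnj (v $ i) * y $ (i, k))"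

lemma sum_UNIV_prod: "(\<Sum>p\<in>UNIV. f p) = (\<Sum>i\<in>UNIV. \<Sum>k\<in>UNIV. f (i, k))"
  for f :: "'a::finite \<times> 'b::finite \<Rightarrow> 'c::comm_monoid_add"
  by (simp add: sum.cartesian_product flip: UNIV_Times_UNIV)

lemma cinner_tensor_vec: "cinner (tensor_vec v x) y = cinner x (contract_A v y)"
proof -
  have "cinner (tensor_vec v x) y = (\<Sum>i\<in>UNIV. \<Sum>k\<in>UNIV. cnj (x $ k) * (cnj (v $ i) * y $ (i, k)))"
    by (simp add: cinner_def tensor_vec_def sum_UNIV_prod mult_ac)
  also have "\<dots> = (\<Sum>k\<in>UNIV. \<Sum>i\<in>UNIV. cnj (x $ k) * (cnj (v $ i) * y $ (i, k)))"
    by (rule sum.swap)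
  finally show ?thesis by (simp add: cinner_def contract_A_def sum_distrib_left)
qed

lemma contract_A_tensor_vec: "contract_A v (tensor_vec w x) = cinner v w *s x"
  by (simp add: vec_eq_iff contract_A_def tensor_vec_def cinner_def sum_distrib_left mult_ac)

lemma tensor_vec_scale_right: "tensor_vec v (c *s x) = c *s tensor_vec v x"
  by (simp add: vec_eq_iff tensor_vec_def mult_ac)

lemma tensor_vec_zero_right [simp]: "tensor_vec v 0 = 0"
  by (simp add: vec_eq_iff tensor_vec_def)

text \<open>The square matrix with columns \<open>v a\<close> has its adjoint as left inverse, hence
  also as right inverse.\<close>

lemma orthonormal_basis_complete:
  assumes "orthonormal_basis v"
  shows "(\<Sum>a\<in>UNIV. v a $ i * cnj (v a $ j)) = (if i = j then 1 else 0)"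
proof -
  define V :: "complex^'a^'a" where "V = (\<chi> i a. v a $ i)"
  have "dagger V ** V = mat 1"
    using assms
    by (simp add: vec_eq_iff matrix_matrix_mult_def V_def dagger_def mat_def orthonormal_basis_def cinner_def)
  then have "V ** dagger V = mat 1"
    by (simp add: matrix_left_right_inverse)
  then have "(V ** dagger V) $ i $ j = (mat 1 :: complex^'a^'a) $ i $ j"
    by simp
  then show ?thesis
    by (simp add: matrix_matrix_mult_def V_def dagger_def mat_def)
qed

lemma orthonormal_basis_expand:
  assumes "orthonormal_basis v"
  shows "y = (\<Sum>a\<in>UNIV. tensor_vec (v a) (contract_A (v a) y))"
proof -
  have "(\<Sum>a\<in>UNIV. tensor_vec (v a) (contract_A (v a) y)) $ (i, k) = y $ (i, k)" for i k
  proof -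
    have "(\<Sum>a\<in>UNIV. tensor_vec (v a) (contract_A (v a) y)) $ (i, k) =
        (\<Sum>a\<in>UNIV. \<Sum>j\<in>UNIV. v a $ i * cnj (v a $ j) * y $ (j, k))"
      by (simp add: tensor_vec_def contract_A_def sum_distrib_left mult_ac)
    also have "\<dots> = (\<Sum>j\<in>UNIV. (\<Sum>a\<in>UNIV. v a $ i * cnj (v a $ j)) * y $ (j, k))"
      by (subst sum.swap) (simp add: sum_distrib_right)
    also have "\<dots> = y $ (i, k)"
      by (simp add: orthonormal_basis_complete[OF assms] if_distrib[of "\<lambda>z. z * _"] cong: if_cong)
    finally show ?thesis .
  qed
  then show ?thesis by (simp add: vec_eq_iff)
qed

section \<open>Conditional states and the range of \<open>\<rho>\<close>\<close>

text \<open>This replaces the partial trace by the compression of \<open>\<rho>\<close> to the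
  vectors \<open>tensor_vec v x\<close>, so that quadratic forms of conditional states become
  quadratic forms of \<open>\<rho>\<close>.\<close>

lemma conditional_state_vector:
  "conditional_state \<rho> (ket_bra v) *v x = contract_A v (\<rho> *v tensor_vec v x)"
proof -
  have entry: "conditional_state \<rho> (ket_bra v) $ k $ l =
      (\<Sum>i\<in>UNIV. \<Sum>j\<in>UNIV. v $ i * cnj (v $ j) * \<rho> $ (j, k) $ (i, l))" for k l
    unfolding conditional_state_def partial_trace_A_def tensor_mat_def matrix_matrix_mult_def
      ket_bra_def mat_def
    by (simp add: sum_UNIV_prod if_distrib[of "\<lambda>z. z * _"] if_distrib[of "\<lambda>z. _ * z"] cong: if_cong)
  have "(conditional_state \<rho> (ket_bra v) *v x) $ k = contract_A v (\<rho> *v tensor_vec v x) $ k" for k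
  proof -
    let ?t = "\<lambda>l i j. cnj (v $ j) * (\<rho> $ (j, k) $ (i, l) * (v $ i * x $ l))"
    have "(conditional_state \<rho> (ket_bra v) *v x) $ k = (\<Sum>l\<in>UNIV. \<Sum>i\<in>UNIV. \<Sum>j\<in>UNIV. ?t l i j)"
      by (simp add: matrix_vector_mult_def entry sum_distrib_left mult_ac)
    also have "\<dots> = (\<Sum>i\<in>UNIV. \<Sum>l\<in>UNIV. \<Sum>j\<in>UNIV. ?t l i j)"
      by (rule sum.swap)
    also have "\<dots> = (\<Sum>i\<in>UNIV. \<Sum>j\<in>UNIV. \<Sum>l\<in>UNIV. ?t l i j)"
      by (intro sum.cong refl sum.swap)
    also have "\<dots> = (\<Sum>j\<in>UNIV. \<Sum>i\<in>UNIV. \<Sum>l\<in>UNIV. ?t l i j)"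
      by (rule sum.swap)
    also have "\<dots> = contract_A v (\<rho> *v tensor_vec v x) $ k"
      by (simp add: contract_A_def matrix_vector_mult_def tensor_vec_def sum_UNIV_prod sum_distrib_left)
    finally show ?thesis .
  qed
  then show ?thesis by (simp add: vec_eq_iff)
qed

text \<open>The quadratic form of \<open>\<rho>\<close> at \<open>tensor_vec v x\<close> equals that
  of \<open>ket_bra b\<close> at \<open>x\<close>, which is 0; positivity does the rest.\<close>

lemma conditional_state_kernel:
  assumes \<rho>: "positive_semidefinite \<rho>"
    and "conditional_state \<rho> (ket_bra v) = ket_bra b" and "cinner b x = 0"
  shows "\<rho> *v tensor_vec v x = 0"
  by (rule positive_semidefinite_kernel[OF \<rho>])
    (simp add: assms ket_bra_vector cinner_tensor_vec flip: conditional_state_vector)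

text \<open>For \<open>x\<close> orthogonal to \<open>b\<close>, moving \<open>\<rho>\<close> to the
  other side of the inner product makes it act on \<open>tensor_vec v x\<close>, which it
  kills.\<close>

lemma contract_A_range:
  assumes \<rho>: "positive_semidefinite \<rho>"
    and "conditional_state \<rho> (ket_bra v) = ket_bra b"
  shows "\<exists>c. contract_A v (\<rho> *v y) = c *s b"
proof (rule double_orthogonal_complement_line)
  fix x assume "cinner b x = 0"
  then have "\<rho> *v tensor_vec v x = 0"
    using assms conditional_state_kernel by blast
  moreover have "hermitian \<rho>"
    using \<rho> by (simp add: positive_semidefinite_def)
  ultimately show "cinner x (contract_A v (\<rho> *v y)) = 0"
    by (simp add: cinner_hermitian flip: cinner_tensor_vec)
qed

text \<open>Both claims come from counting dimensions: a range of dimension at least 2 inside the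
  span of two vectors fills that span, and neither vector can be 0.\<close>

lemma tensor_vec_in_range:
  assumes \<rho>: "positive_semidefinite \<rho>" and rk: "2 \<le> rank \<rho>"
    and w: "orthonormal_basis w"
    and c: "\<And>a. conditional_state \<rho> (ket_bra (w a)) = ket_bra (c a)"
  shows "c a \<noteq> 0" and "tensor_vec (w a) (c a) \<in> range ((*v) \<rho>)"
proof -
  define f where "f a = tensor_vec (w a) (c a)" for a
  have sub: "range ((*v) \<rho>) \<subseteq> vec.span (range f)"
  proof clarify
    fix y
    have "\<exists>d. contract_A (w a) (\<rho> *v y) = d *s c a" for a
      using contract_A_range[OF \<rho> c] .
    then obtain \<gamma> where \<gamma>: "contract_A (w a) (\<rho> *v y) = \<gamma> a *s c a" for a
      by metis
    have "\<rho> *v y = (\<Sum>a\<in>UNIV. \<gamma> a *s f a)"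
      by (subst orthonormal_basis_expand[OF w]) (simp add: \<gamma> tensor_vec_scale_right f_def)
    then show "\<rho> *v y \<in> vec.span (range f)"
      by (simp add: vec.span_sum vec.span_scale vec.span_base)
  qed
  have rk': "2 \<le> vec.dim (range ((*v) \<rho>))"
    using rk rank_le_dim_range[of \<rho>] by simp
  have "vec.dim (range f) \<le> 2"
    using vec.dim_le_card'[of "range f"] card_image_le[of UNIV f] by simp
  then have eq: "range ((*v) \<rho>) = vec.span (range f)"
    using rk' sub by (intro vec.subspace_dim_equal) (auto intro: vec.subspace_UNIV vec.subspace_image)
  show "tensor_vec (w a) (c a) \<in> range ((*v) \<rho>)"
    unfolding eq by (rule vec.span_base) (simp add: f_def)
  show "c a \<noteq> 0"
  proof
    assume "c a = 0"
    then have "f a = 0" by (simp add: f_def)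
    \<comment> \<open>Without the zero vector \<open>f a\<close>, a single vector would span the
      whole range.\<close>
    then have "vec.span (range f) \<subseteq> vec.span (f ` (UNIV - {a}))"
      by (intro vec.span_minimal image_subsetI) (metis DiffI UNIV_I imageI singletonD vec.span_base vec.span_zero, simp)
    then have "vec.dim (range ((*v) \<rho>)) \<le> card (f ` (UNIV - {a}))"
      using eq by (intro vec.dim_le_card) auto
    also have "\<dots> \<le> card (UNIV - {a})"
      by (rule card_image_le) simp
    also have "\<dots> = 1" by simp
    finally show False using rk' by simp
  qed
qed

text \<open>An outcome of zero probability is given \<open>b a = 0\<close>, so that both outcomes
  can be treated alike.\<close>

lemma pure_conditional_states:
  assumes "projective_measurement P" "\<forall>\<sigma> \<in> conditional_states \<rho> P. pure_unnormalized \<sigma>"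
  obtains v b where "orthonormal_basis v" "\<And>a. P a = ket_bra (v a)"
    "\<And>a. conditional_state \<rho> (ket_bra (v a)) = ket_bra (b a)"
proof -
  obtain v where v: "orthonormal_basis v" "\<And>a. P a = ket_bra (v a)"
    using assms(1) unfolding projective_measurement_def by blast
  have "\<exists>b. conditional_state \<rho> (P a) = ket_bra b" for a
  proof (cases "conditional_state \<rho> (P a) = 0")
    case True
    then show ?thesis by (metis ket_bra_eq_0_iff)
  next
    case False
    then have "pure_unnormalized (conditional_state \<rho> (P a))"
      using assms(2) by (simp add: conditional_states_def)
    then show ?thesis by (metis pure_unnormalized_ket_bra)
  qed
  then show thesis using that v by metis
qed

theorem corollary1:
  fixes \<rho> :: "complex^(2 \<times> 2)^(2 \<times> 2)"
  assumes "density_matrix \<rho>"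
    and "rank \<rho> \<ge> 2"
  shows "\<not> (\<exists>P Q. projective_measurement P \<and> projective_measurement Q \<and> contradiction_2_eq_1 \<rho> P Q)"
proof clarify
  fix P Q
  assume PQ: "projective_measurement P" "projective_measurement Q" "contradiction_2_eq_1 \<rho> P Q"
  have \<rho>: "positive_semidefinite \<rho>"
    using assms(1) by (simp add: density_matrix_def)
  have pure: "\<forall>\<sigma> \<in> conditional_states \<rho> P. pure_unnormalized \<sigma>"
    "\<forall>\<sigma> \<in> conditional_states \<rho> Q. pure_unnormalized \<sigma>"
    using PQ(3) by (auto simp: contradiction_2_eq_1_def pure_state_requirement_def)
  obtain v b where v: "orthonormal_basis v" "\<And>a. P a = ket_bra (v a)"
    and b: "\<And>a. conditional_state \<rho> (ket_bra (v a)) = ket_bra (b a)"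
    using pure_conditional_states[OF PQ(1) pure(1)] by blast
  obtain w c where w: "orthonormal_basis w" "\<And>a. Q a = ket_bra (w a)"
    and c: "\<And>a. conditional_state \<rho> (ket_bra (w a)) = ket_bra (c a)"
    using pure_conditional_states[OF PQ(2) pure(2)] by blast
  have c0: "c 0 \<noteq> 0"
    using tensor_vec_in_range(1)[OF \<rho> assms(2) w(1) c] .
  obtain y where y: "tensor_vec (w 0) (c 0) = \<rho> *v y"
    using tensor_vec_in_range(2)[OF \<rho> assms(2) w(1) c, of 0] by blast
  \<comment> \<open>The vector \<open>\<rho> *v y\<close> is nonzero, so its expansion along
    \<open>v\<close> has a nonzero component, and that component is
    \<open>cinner (v a) (w 0) *s c 0\<close>.\<close>
  obtain a where a: "cinner (v a) (w 0) \<noteq> 0"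
  proof -
    have "\<rho> *v y \<noteq> 0"
    proof
      have "cinner (w 0) (w 0) = 1"
        using w(1) by (simp add: orthonormal_basis_def)
      moreover assume "\<rho> *v y = 0"
      then have "cinner (w 0) (w 0) *s c 0 = 0"
        using contract_A_tensor_vec[of "w 0" "w 0" "c 0"] by (simp add: y contract_A_def vec_eq_iff)
      ultimately show False
        using c0 by simp
    qed
    then obtain a where "contract_A (v a) (\<rho> *v y) \<noteq> 0"
      using orthonormal_basis_expand[OF v(1), of "\<rho> *v y"] by fastforce
    then have "cinner (v a) (w 0) \<noteq> 0"
      by (auto simp: contract_A_tensor_vec simp flip: y)
    then show thesis by (rule that)
  qed
  \<comment> \<open>Contraction of the product vector \<open>\<rho> *v y\<close> with
    \<open>v a\<close>, computed in two ways.\<close>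
  obtain \<gamma> where "cinner (v a) (w 0) *s c 0 = \<gamma> *s b a"
    using contract_A_range[OF \<rho> b, of a y] by (auto simp: contract_A_tensor_vec simp flip: y)
  then have "c 0 = (\<gamma> / cinner (v a) (w 0)) *s b a"
    using a by (auto simp: vec_eq_iff field_simps)
  then obtain d where d: "c 0 = d *s b a" by blast
  then have "d \<noteq> 0" "b a \<noteq> 0" using c0 by auto
  \<comment> \<open>Scaling a vector by \<open>d\<close> scales its \<open>ket_bra\<close> by
    \<open>d * cnj d\<close>; the inverse factor leads back from \<open>c 0\<close> to
    \<open>b a\<close>.\<close>
  have bc: "ket_bra (b a) = map_matrix (\<lambda>z. (1 / (d * cnj d)) * z) (ket_bra (c 0))"
    unfolding d ket_bra_scale using \<open>d \<noteq> 0\<close> by (simp add: vec_eq_iff map_matrix_def)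
  have "proportional (ket_bra (b a)) (ket_bra (c 0))"
    unfolding proportional_def
    by (rule exI[of _ "1 / (d * cnj d)"], intro conjI bc) (use \<open>d \<noteq> 0\<close> in simp)
  \<comment> \<open>As \<open>b a\<close> is nonzero, the outcome has positive probability and its
    state is subject to the measurement requirement.\<close>
  moreover have "ket_bra (b a) \<in> conditional_states \<rho> P"
    using b[of a] v(2)[of a] \<open>b a \<noteq> 0\<close> by (auto simp: conditional_states_def image_iff intro: exI[of _ a])
  moreover have "ket_bra (c 0) \<in> conditional_states \<rho> Q"
    using c[of 0] w(2)[of 0] c0 by (auto simp: conditional_states_def image_iff intro: exI[of _ 0])
  ultimately show False
    using PQ(3) by (auto simp: contradiction_2_eq_1_def measurement_requirement_def)
qed

end
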